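(* Let $\mathcal{B}$ be a real Banach space having a pre-dual space $\mathcal{B}_*$. Let $n\ge 1$, let $\nu_1,\dots,\nu_n\in\mathcal{B}_*$ be linearly independent, let $\mathbf{y}=(y_1,\dots,y_n)\in\mathbb{R}^n\setminus\{\mathbf{0}\}$, and put $\mathcal{V}:=\mathrm{span}\{\nu_1,\dots,\nu_n\}$ and $\mathcal{M}_{\mathbf{y}}:=\{f\in\mathcal{B}:\langle\nu_j,f\rangle_{\mathcal{B}}=y_j,\ j=1,\dots,n\}$. Let $\mathrm{S}(\mathbf{y})$ be the set of all $f\in\mathcal{M}_{\mathbf{y}}$ with $\|f\|_{\mathcal{B}}=\inf\{\|h\|_{\mathcal{B}}:h\in\mathcal{M}_{\mathbf{y}}\}$. Suppose $\hat\nu\in\mathcal{V}$ satisfies $$\bigl(\|\hat\nu\|_{\mathcal{B}_*}\,\partial\|\cdot\|_{\mathcal{B}_*}(\hat\nu)\bigr)\cap\mathcal{M}_{\mathbf{y}}\neq\emptyset .$$ Then for every extreme point $\hat f$ of $\mathrm{S}(\mathbf{y})$ there exist $\gamma_1,\dots,\gamma_n\in\mathbb{R}$ with $\sum_{j=1}^n\gamma_j=\|\hat\nu\|_{\mathcal{B}_*}$ and $u_1,\dots,u_n\in\mathrm{ext}\bigl(\partial\|\cdot\|_{\mathcal{B}_*}(\hat\nu)\bigr)$ such that $$\hat f=\sum_{j=1}^n\gamma_j u_j .$$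
   Context: A Banach space $\mathcal{B}$ has a pre-dual space $\mathcal{B}_*$ if $\mathcal{B}_*$ is a Banach space with $(\mathcal{B}_* )^*=\mathcal{B}$ (isometric identification). Elements $\nu\in\mathcal{B}_*$ are regarded as bounded linear functionals on $\mathcal{B}$ through $\langle\nu,f\rangle_{\mathcal{B}}=\langle f,\nu\rangle_{\mathcal{B}_*}=f(\nu)$, $f\in\mathcal{B}$. The subdifferential $\partial\|\cdot\|_{\mathcal{B}_*}(\nu)\subset(\mathcal{B}_* )^*=\mathcal{B}$ of the norm of $\mathcal{B}_*$ at $\nu$ is the set of $f\in\mathcal{B}$ with $\|\mu\|_{\mathcal{B}_*}-\|\nu\|_{\mathcal{B}_*}\ge\langle f,\mu-\nu\rangle_{\mathcal{B}_*}$ for all $\mu\in\mathcal{B}_*$. $\mathrm{ext}(A)$ denotes the set of extreme points of a convex set $A$. *)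

theory Defs
  imports "HOL-Analysis.Analysis"
begin

text \<open>
  \<open>isometric_dual J\<close>: the map \<open>J\<close> identifies \<open>'b\<close> isometrically with the (topological) dual of
  \<open>'a\<close>, so that \<open>'a\<close> is a pre-dual of \<open>'b\<close>.  The duality pairing \<open>\<langle>\<nu>, f\<rangle>\<close> is \<open>blinfun_apply (J f) \<nu>\<close>.
\<close>

definition isometric_dual :: "('b::real_normed_vector \<Rightarrow> ('a::real_normed_vector \<Rightarrow>\<^sub>L real)) \<Rightarrow> bool"
  where "isometric_dual J \<longleftrightarrow> linear J \<and> bij J \<and> (\<forall>f. norm (J f) = norm f)"

definition norm_subdifferential ::
    "('b::real_normed_vector \<Rightarrow> ('a::real_normed_vector \<Rightarrow>\<^sub>L real)) \<Rightarrow> 'a \<Rightarrow> 'b set"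
  where "norm_subdifferential J \<nu> =
    {f. \<forall>\<mu>. norm \<mu> - norm \<nu> \<ge> blinfun_apply (J f) (\<mu> - \<nu>)}"

text \<open>Families \<open>\<nu>\<close>, \<open>y\<close> are indexed by \<open>{1..n}\<close>; values outside this range are irrelevant.\<close>

definition interpolants ::
    "('b::real_normed_vector \<Rightarrow> ('a::real_normed_vector \<Rightarrow>\<^sub>L real))
      \<Rightarrow> nat \<Rightarrow> (nat \<Rightarrow> 'a) \<Rightarrow> (nat \<Rightarrow> real) \<Rightarrow> 'b set"
  where "interpolants J n \<nu> y = {f. \<forall>j\<in>{1..n}. blinfun_apply (J f) (\<nu> j) = y j}"

definition min_norm_interpolants ::
    "('b::real_normed_vector \<Rightarrow> ('a::real_normed_vector \<Rightarrow>\<^sub>L real))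
      \<Rightarrow> nat \<Rightarrow> (nat \<Rightarrow> 'a) \<Rightarrow> (nat \<Rightarrow> real) \<Rightarrow> 'b set"
  where "min_norm_interpolants J n \<nu> y =
    {f \<in> interpolants J n \<nu> y. norm f = (INF h\<in>interpolants J n \<nu> y. norm h)}"

end

theory Submission imports Defs begin

text \<open>
  Put \<open>r = \<parallel>\<nu>_hat\<parallel>\<close>.  Every \<open>h\<close> interpolating the data takes the same value at \<open>\<nu>_hat\<close>, because
  \<open>\<nu>_hat\<close> lies in the span of the \<open>\<nu> j\<close>; the interpolant assumed to exist in \<open>r\<close> times the
  subdifferential shows that this value is \<open>r\<^sup>2\<close> and that the minimal norm is \<open>r\<close>.  Hence
  the minimal norm interpolants are exactly the interpolants in \<open>r \<cdot> C\<close>, where \<open>C\<close> is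
  the subdifferential of the norm at \<open>\<nu>_hat\<close>, a closed, bounded and convex set
  (\<open>min_norm_interpolant_iff\<close>).

  If \<open>f_hat\<close> is an extreme point of this section of \<open>r \<cdot> C\<close>, consider the
  directions in which one can move from \<open>x = f_hat / r\<close> both ways without leaving \<open>C\<close>.  They form
  a subspace, on which \<open>\<nu>_hat\<close> vanishes since it is constant on \<open>C\<close>, and which contains no
  nonzero vector annihilated by all the \<open>\<nu> j\<close>, since \<open>f_hat\<close> is extreme.  The data \<open>y\<close>
  are not all zero, so \<open>\<nu>_hat\<close> is nonzero and a nontrivial combination of the \<open>\<nu> j\<close>;
  hence one of these may be dropped: \<open>n - 1\<close> functionals already separate the points of the subspace, so its dimension is at most \<open>n - 1\<close>.  In other words, \<open>x\<close>
  lies in the relative interior of a face of \<open>C\<close> of dimension at most \<open>n - 1\<close>, and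
  the theorems of Minkowski and Caratheodory in that face make \<open>x\<close> a convex combination of \<open>n\<close>
  extreme points of \<open>C\<close> (\<open>convex_combination_of_extreme_points\<close>).
\<close>

section \<open>Directions of two-sided motion in a convex set\<close>

text \<open>For convex \<open>C\<close> and \<open>x \<in> C\<close> this is the direction space of the smallest face of \<open>C\<close> that
  contains \<open>x\<close>.\<close>

definition two_sided_directions :: "'a::real_vector set \<Rightarrow> 'a \<Rightarrow> 'a set"
  where "two_sided_directions C x = {d. \<exists>\<epsilon>>0. x + \<epsilon> *\<^sub>R d \<in> C \<and> x - \<epsilon> *\<^sub>R d \<in> C}"

lemma convex_shorter_step:
  fixes x :: "'a::real_vector"
  assumes "convex C" "x \<in> C" "x + s *\<^sub>R d \<in> C" "0 \<le> \<epsilon>" "\<epsilon> \<le> s"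
  shows "x + \<epsilon> *\<^sub>R d \<in> C"
proof (cases "s = 0")
  case False
  with assms have s: "s > 0" by simp
  have "(1 - \<epsilon>/s) *\<^sub>R x + (\<epsilon>/s) *\<^sub>R (x + s *\<^sub>R d) \<in> C"
    by (rule convexD) (use assms s in \<open>auto simp: field_simps\<close>)
  also have "(1 - \<epsilon>/s) *\<^sub>R x + (\<epsilon>/s) *\<^sub>R (x + s *\<^sub>R d) = x + \<epsilon> *\<^sub>R d"
    using s by (simp add: algebra_simps)
  finally show ?thesis .
qed (use assms in auto)

lemma two_sided_directionsI:
  fixes x :: "'a::real_vector"
  assumes "convex C" "x \<in> C" "s > 0" "t > 0" "x + s *\<^sub>R d \<in> C" "x - t *\<^sub>R d \<in> C"
  shows "d \<in> two_sided_directions C x"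
proof -
  have "x + min s t *\<^sub>R d \<in> C"
    using convex_shorter_step[of C x s d "min s t"] assms by auto
  moreover have "x + min s t *\<^sub>R (- d) \<in> C"
    using convex_shorter_step[of C x t "- d" "min s t"] assms by auto
  ultimately show ?thesis
    unfolding two_sided_directions_def using assms by (auto intro!: exI[of _ "min s t"])
qed

lemma subspace_two_sided_directions:
  fixes x :: "'a::real_vector"
  assumes "convex C" "x \<in> C"
  shows "subspace (two_sided_directions C x)"
  unfolding subspace_def
proof (intro conjI ballI allI)
  show "0 \<in> two_sided_directions C x"
    using assms by (auto simp: two_sided_directions_def intro: exI[of _ 1])
next
  fix d e assume "d \<in> two_sided_directions C x" "e \<in> two_sided_directions C x"
  then obtain a b where ab: "a > 0" "x + a *\<^sub>R d \<in> C" "x - a *\<^sub>R d \<in> C"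
      "b > 0" "x + b *\<^sub>R e \<in> C" "x - b *\<^sub>R e \<in> C"
    by (auto simp: two_sided_directions_def)
  \<comment> \<open>The weights \<open>b / (a + b)\<close> and \<open>a / (a + b)\<close> equalise the two step lengths.\<close>
  define c where "c = a * b / (a + b)"
  have "c > 0" using ab by (simp add: c_def)
  have w: "b / (a + b) + a / (a + b) = 1"
    using ab by (simp add: add_divide_distrib[symmetric] add.commute)
  have eq: "(b / (a + b)) *\<^sub>R (x + a *\<^sub>R u) + (a / (a + b)) *\<^sub>R (x + b *\<^sub>R v) = x + c *\<^sub>R (u + v)" for u v
  proof -
    have "(b / (a + b)) *\<^sub>R (x + a *\<^sub>R u) + (a / (a + b)) *\<^sub>R (x + b *\<^sub>R v)
        = (b / (a + b) + a / (a + b)) *\<^sub>R x + c *\<^sub>R (u + v)"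
      unfolding scaleR_left_distrib by (simp add: c_def algebra_simps)
    then show ?thesis unfolding w by simp
  qed
  have "x + c *\<^sub>R (d + e) \<in> C"
    unfolding eq[symmetric] by (rule convexD) (use assms ab w in auto)
  moreover have "x + c *\<^sub>R (- d + - e) \<in> C"
    unfolding eq[symmetric] by (rule convexD) (use assms ab w in auto)
  ultimately show "d + e \<in> two_sided_directions C x"
    unfolding two_sided_directions_def using \<open>c > 0\<close>
    by (auto intro!: exI[of _ c] simp: algebra_simps)
next
  fix r :: real and d assume "d \<in> two_sided_directions C x"
  then obtain a where a: "a > 0" "x + a *\<^sub>R d \<in> C" "x - a *\<^sub>R d \<in> C"
    by (auto simp: two_sided_directions_def)
  consider "r = 0" | "r > 0" | "r < 0" by linarith
  then show "r *\<^sub>R d \<in> two_sided_directions C x"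
  proof cases
    case 1
    then show ?thesis
      using assms by (auto simp: two_sided_directions_def intro: exI[of _ 1])
  next
    case 2
    then show ?thesis using a
      by (auto simp: two_sided_directions_def intro!: exI[of _ "a / r"])
  next
    case 3
    then show ?thesis using a
      by (auto simp: two_sided_directions_def divide_pos_neg intro!: exI[of _ "- a / r"])
  qed
qed

lemma extreme_point_of_iff_two_sided_directions:
  fixes x :: "'a::real_vector"
  assumes "convex C"
  shows "x extreme_point_of C \<longleftrightarrow> x \<in> C \<and> two_sided_directions C x \<subseteq> {0}"
proof (intro iffI conjI subsetI)
  assume ext: "x extreme_point_of C"
  then show "x \<in> C" by (simp add: extreme_point_of_def)
  fix d assume "d \<in> two_sided_directions C x"
  then obtain a where a: "a > 0" "x + a *\<^sub>R d \<in> C" "x - a *\<^sub>R d \<in> C"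
    by (auto simp: two_sided_directions_def)
  have mid: "midpoint (x - a *\<^sub>R d) (x + a *\<^sub>R d) = x"
    by (simp add: midpoint_def scaleR_2[symmetric])
  have "x \<notin> open_segment (x - a *\<^sub>R d) (x + a *\<^sub>R d)"
    using ext a by (simp add: extreme_point_of_def)
  then have "x - a *\<^sub>R d = x + a *\<^sub>R d"
    using mid by (metis midpoint_in_open_segment)
  then have "(2 * a) *\<^sub>R d = 0"
    by (metis add_diff_cancel_left' cancel_comm_monoid_add_class.diff_cancel diff_diff_eq2
        mult_2 scaleR_left_distrib add.commute diff_add_eq)
  then show "d \<in> {0}" using a by simp
next
  assume x: "x \<in> C \<and> two_sided_directions C x \<subseteq> {0}"
  show "x extreme_point_of C"
    unfolding extreme_point_of_def
  proof (intro conjI ballI notI)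
    show "x \<in> C" using x by simp
    fix a b assume ab: "a \<in> C" "b \<in> C" "x \<in> open_segment a b"
    then obtain u where u: "a \<noteq> b" "0 < u" "u < 1" "x = (1 - u) *\<^sub>R a + u *\<^sub>R b"
      by (auto simp: in_segment)
    have "x + (1 - u) *\<^sub>R (b - a) = b" "x - u *\<^sub>R (b - a) = a"
      using u by (simp_all add: algebra_simps)
    then have "b - a \<in> two_sided_directions C x"
      using two_sided_directionsI[of C x "1 - u" u "b - a"] assms x ab u by auto
    then show False using x u by auto
  qed
qed

text \<open>If \<open>x\<close> divides a segment from \<open>z\<close> to \<open>v\<close>, shrinking a motion about \<open>z\<close> towards \<open>v\<close> gives a
  motion about \<open>x\<close>: the smallest face containing \<open>z\<close> lies in the smallest face containing \<open>x\<close>.\<close>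

lemma two_sided_directions_mono:
  fixes z :: "'a::real_vector"
  assumes "convex C" "v \<in> C" "0 < a" "0 \<le> b" "a + b = 1"
  shows "two_sided_directions C z \<subseteq> two_sided_directions C (a *\<^sub>R z + b *\<^sub>R v)"
proof
  fix d assume "d \<in> two_sided_directions C z"
  then obtain c where c: "c > 0" "z + c *\<^sub>R d \<in> C" "z - c *\<^sub>R d \<in> C"
    by (auto simp: two_sided_directions_def)
  have "a *\<^sub>R (z + c *\<^sub>R d) + b *\<^sub>R v \<in> C" "a *\<^sub>R (z - c *\<^sub>R d) + b *\<^sub>R v \<in> C"
    using assms c by (auto intro!: convexD)
  then show "d \<in> two_sided_directions C (a *\<^sub>R z + b *\<^sub>R v)"
    unfolding two_sided_directions_def using assms c
    by (auto intro!: exI[of _ "a * c"] simp: algebra_simps)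
qed

section \<open>Convex combinations of extreme points\<close>

lemma last_point_on_ray:
  fixes x d :: "'a::real_normed_vector"
  assumes "closed C" "bounded C" "x \<in> C" "d \<noteq> 0"
  obtains t where "t \<ge> 0" "x + t *\<^sub>R d \<in> C" "\<And>s. s > t \<Longrightarrow> x + s *\<^sub>R d \<notin> C"
proof -
  let ?T = "{0..} \<inter> (\<lambda>t. x + t *\<^sub>R d) -` C"
  have "closed ?T"
    by (intro closed_Int closed_vimage assms) (auto intro!: continuous_intros)
  moreover have "bounded ?T"
  proof -
    obtain B where B: "\<And>c. c \<in> C \<Longrightarrow> norm c \<le> B"
      using assms(2) by (auto simp: bounded_iff)
    have "norm t \<le> (B + norm x) / norm d" if "x + t *\<^sub>R d \<in> C" for t
    proof -
      have "norm (t *\<^sub>R d) \<le> norm (x + t *\<^sub>R d) + norm x"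
        by (metis add_diff_cancel_left' norm_triangle_ineq4)
      also have "\<dots> \<le> B + norm x" using B[OF that] by simp
      finally show ?thesis using assms(4) by (simp add: field_simps)
    qed
    then show ?thesis unfolding bounded_iff by blast
  qed
  ultimately have "compact ?T" by (simp add: compact_eq_bounded_closed)
  moreover have "?T \<noteq> {}" using assms(3) by (auto intro!: exI[of _ 0])
  ultimately obtain t where t: "t \<in> ?T" "\<forall>s\<in>?T. s \<le> t"
    using compact_attains_sup by blast
  have "x + s *\<^sub>R d \<notin> C" if "s > t" for s
  proof
    assume "x + s *\<^sub>R d \<in> C"
    then have "s \<in> ?T" using t that by simp
    then have "s \<le> t" using t(2) by blast
    then show False using that by simp
  qed
  then show ?thesis using t by (intro that[of t]) auto
qed

text \<open>Running to the end of \<open>C\<close> in a direction \<open>d\<close> of two-sided motion loses that direction and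
  gains none, so it lowers the dimension.  This is the step of both inductions below.\<close>

lemma last_point_fewer_directions:
  fixes x d :: "'a::real_normed_vector"
  assumes C: "convex C" "closed C" "bounded C"
    and d: "d \<in> two_sided_directions C x" "d \<noteq> 0"
    and bound: "\<And>B. finite B \<Longrightarrow> independent B \<Longrightarrow> B \<subseteq> two_sided_directions C x \<Longrightarrow> card B \<le> Suc k"
  obtains t where "t \<ge> 0" "x + t *\<^sub>R d \<in> C"
    "\<And>B. finite B \<Longrightarrow> independent B \<Longrightarrow> B \<subseteq> two_sided_directions C (x + t *\<^sub>R d) \<Longrightarrow> card B \<le> k"
proof -
  obtain \<epsilon> where \<epsilon>: "\<epsilon> > 0" "x + \<epsilon> *\<^sub>R d \<in> C" "x - \<epsilon> *\<^sub>R d \<in> C"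
    using d by (auto simp: two_sided_directions_def)
  have "midpoint (x + \<epsilon> *\<^sub>R d) (x - \<epsilon> *\<^sub>R d) \<in> C"
    using C(1) \<epsilon> by (meson closed_segment_subset midpoint_in_closed_segment subsetD)
  then have "x \<in> C" by (simp add: midpoint_def scaleR_2[symmetric])
  obtain t where t: "t \<ge> 0" "x + t *\<^sub>R d \<in> C" "\<And>s. s > t \<Longrightarrow> x + s *\<^sub>R d \<notin> C"
    using last_point_on_ray[OF C(2,3) \<open>x \<in> C\<close> d(2)] by metis
  let ?z = "x + t *\<^sub>R d"
  have lost: "d \<notin> two_sided_directions C ?z"
  proof
    assume "d \<in> two_sided_directions C ?z"
    then obtain c where "c > 0" "?z + c *\<^sub>R d \<in> C" by (auto simp: two_sided_directions_def)
    then show False using t(3)[of "t + c"] by (simp add: algebra_simps)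
  qed
  have "x = (\<epsilon> / (\<epsilon> + t)) *\<^sub>R ?z + (t / (\<epsilon> + t)) *\<^sub>R (x - \<epsilon> *\<^sub>R d)"
  proof -
    have "(\<epsilon> / (\<epsilon> + t)) *\<^sub>R ?z + (t / (\<epsilon> + t)) *\<^sub>R (x - \<epsilon> *\<^sub>R d)
        = (\<epsilon> / (\<epsilon> + t) + t / (\<epsilon> + t)) *\<^sub>R x"
      unfolding scaleR_left_distrib by (simp add: algebra_simps)
    moreover have "\<epsilon> / (\<epsilon> + t) + t / (\<epsilon> + t) = 1" using \<epsilon> t by (simp add: add_divide_distrib[symmetric])
    ultimately show ?thesis by simp
  qed
  moreover have "two_sided_directions C ?z
      \<subseteq> two_sided_directions C ((\<epsilon> / (\<epsilon> + t)) *\<^sub>R ?z + (t / (\<epsilon> + t)) *\<^sub>R (x - \<epsilon> *\<^sub>R d))"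
    using C(1) \<epsilon> t by (intro two_sided_directions_mono) (auto simp: add_divide_distrib[symmetric])
  ultimately have sub: "two_sided_directions C ?z \<subseteq> two_sided_directions C x" by simp
  have "card B \<le> k" if B: "finite B" "independent B" "B \<subseteq> two_sided_directions C ?z" for B
  proof -
    have "span B \<subseteq> two_sided_directions C ?z"
      using subspace_two_sided_directions[OF C(1) t(2)] B(3) by (simp add: span_minimal)
    then have "d \<notin> span B" using lost by auto
    then have "independent (insert d B)" "d \<notin> B"
      using B by (auto simp: independent_insert intro: span_base)
    then have "card (insert d B) \<le> Suc k" using B sub d by (intro bound) auto
    then show ?thesis using B \<open>d \<notin> B\<close> by simp
  qed
  then show ?thesis using t that by blast
qed

lemma no_directions_if_no_independent_set:
  fixes x :: "'a::real_vector"
  assumes "\<And>B. finite B \<Longrightarrow> independent B \<Longrightarrow> B \<subseteq> two_sided_directions C x \<Longrightarrow> card B \<le> 0"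
  shows "two_sided_directions C x \<subseteq> {0}"
proof
  fix d assume d: "d \<in> two_sided_directions C x"
  then show "d \<in> {0}" using assms[of "{d}"] by auto
qed

text \<open>The conclusion \<open>x + \<epsilon> *\<^sub>R (x - e) \<in> C\<close> says that \<open>e\<close> lies in the smallest face
  containing \<open>x\<close>.\<close>

lemma extreme_point_in_smallest_face:
  fixes x :: "'a::real_normed_vector"
  assumes C: "convex C" "closed C" "bounded C" and "x \<in> C"
    and "\<And>B. finite B \<Longrightarrow> independent B \<Longrightarrow> B \<subseteq> two_sided_directions C x \<Longrightarrow> card B \<le> k"
  shows "\<exists>e \<epsilon>. e extreme_point_of C \<and> \<epsilon> > 0 \<and> x + \<epsilon> *\<^sub>R (x - e) \<in> C"
  using assms(4,5)
proof (induction k arbitrary: x)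
  case 0
  then have "x extreme_point_of C"
    using no_directions_if_no_independent_set[of C x]
    by (simp add: extreme_point_of_iff_two_sided_directions[OF C(1)])
  then show ?case using 0 by (intro exI[of _ x] exI[of _ 1]) simp
next
  case (Suc k)
  show ?case
  proof (cases "two_sided_directions C x \<subseteq> {0}")
    case True
    then have "x extreme_point_of C"
      using Suc.prems by (simp add: extreme_point_of_iff_two_sided_directions[OF C(1)])
    then show ?thesis using Suc.prems by (intro exI[of _ x] exI[of _ 1]) simp
  next
    case False
    then obtain d where d: "d \<in> two_sided_directions C x" "d \<noteq> 0" by auto
    then obtain \<delta> where \<delta>: "\<delta> > 0" "x - \<delta> *\<^sub>R d \<in> C"
      by (auto simp: two_sided_directions_def)
    obtain t where t: "t \<ge> 0" "x + t *\<^sub>R d \<in> C"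
      "\<And>B. finite B \<Longrightarrow> independent B \<Longrightarrow> B \<subseteq> two_sided_directions C (x + t *\<^sub>R d) \<Longrightarrow> card B \<le> k"
      using last_point_fewer_directions[OF C d Suc.prems(2)] by blast
    obtain e \<epsilon> where e: "e extreme_point_of C" "\<epsilon> > 0"
        "x + t *\<^sub>R d + \<epsilon> *\<^sub>R (x + t *\<^sub>R d - e) \<in> C"
      using Suc.IH[OF t(2,3)] by blast
    \<comment> \<open>\<open>x\<close> divides the segment from \<open>x - \<delta> *\<^sub>R d\<close> to \<open>w = x + t *\<^sub>R d\<close>, and \<open>w\<close> divides the segment
      from \<open>e\<close> to \<open>p\<close>.  So \<open>x\<close> is a combination of the three points \<open>x - \<delta> *\<^sub>R d\<close>, \<open>p\<close> and \<open>e\<close> with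
      a positive weight at \<open>e\<close>; solving for a multiple of \<open>x - e\<close> gives \<open>\<eta>\<close>.\<close>
    define p where "p = x + t *\<^sub>R d + \<epsilon> *\<^sub>R (x + t *\<^sub>R d - e)"
    define D where "D = \<delta> + t * (1 + \<epsilon>)"
    define \<eta> where "\<eta> = \<delta> * \<epsilon> / D"
    have D: "D > 0" using \<delta> t e by (simp add: D_def add_pos_nonneg)
    have "(\<delta> / D) *\<^sub>R p + (t * (1 + \<epsilon>) / D) *\<^sub>R (x - \<delta> *\<^sub>R d) \<in> C"
      using e \<delta> t D by (intro convexD[OF C(1)])
        (auto simp: p_def D_def add_divide_distrib[symmetric])
    moreover have "(\<delta> / D) *\<^sub>R p + (t * (1 + \<epsilon>) / D) *\<^sub>R (x - \<delta> *\<^sub>R d) = x + \<eta> *\<^sub>R (x - e)"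
    proof -
      have "\<delta> *\<^sub>R p + (t * (1 + \<epsilon>)) *\<^sub>R (x - \<delta> *\<^sub>R d) = D *\<^sub>R x + (\<delta> * \<epsilon>) *\<^sub>R (x - e)"
        by (simp add: p_def D_def algebra_simps)
      then have "(1 / D) *\<^sub>R (\<delta> *\<^sub>R p + (t * (1 + \<epsilon>)) *\<^sub>R (x - \<delta> *\<^sub>R d))
          = (1 / D) *\<^sub>R (D *\<^sub>R x + (\<delta> * \<epsilon>) *\<^sub>R (x - e))" by simp
      then show ?thesis using D by (simp add: scaleR_right_distrib \<eta>_def)
    qed
    moreover have "\<eta> > 0" using D \<delta> e by (simp add: \<eta>_def)
    ultimately show ?thesis using e by (intro exI[of _ e] exI[of _ \<eta>]) simp
  qed
qed

text \<open>Minkowski's and Caratheodory's theorems at once, for a point whose smallest face has dimension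
  at most \<open>k\<close>: take an extreme point \<open>e\<close> of the face and prolong the segment from \<open>e\<close> through \<open>x\<close>
  until it leaves \<open>C\<close>, at \<open>z\<close>.  The smallest face of \<open>z\<close> has lower dimension, and \<open>x\<close> lies between
  \<open>e\<close> and \<open>z\<close>, so each dimension costs one extreme point.\<close>

theorem convex_combination_of_extreme_points:
  fixes x :: "'a::real_normed_vector"
  assumes C: "convex C" "closed C" "bounded C" and "x \<in> C"
    and "\<And>B. finite B \<Longrightarrow> independent B \<Longrightarrow> B \<subseteq> two_sided_directions C x \<Longrightarrow> card B \<le> k"
  shows "\<exists>(c :: nat \<Rightarrow> real) u. (\<forall>j\<in>{1..Suc k}. 0 \<le> c j \<and> u j extreme_point_of C) \<and>
    (\<Sum>j=1..Suc k. c j) = 1 \<and> x = (\<Sum>j=1..Suc k. c j *\<^sub>R u j)"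
  using assms(4,5)
proof (induction k arbitrary: x)
  case 0
  then have "x extreme_point_of C"
    using no_directions_if_no_independent_set[of C x]
    by (simp add: extreme_point_of_iff_two_sided_directions[OF C(1)])
  then show ?case by (intro exI[of _ "\<lambda>_. 1"] exI[of _ "\<lambda>_. x"]) simp
next
  case (Suc k)
  obtain e \<epsilon> where e: "e extreme_point_of C" "\<epsilon> > 0" "x + \<epsilon> *\<^sub>R (x - e) \<in> C"
    using extreme_point_in_smallest_face[OF C Suc.prems] by blast
  have "e \<in> C" using e by (simp add: extreme_point_of_def)
  show ?case
  proof (cases "x = e")
    case True
    have "(\<Sum>j=1..Suc (Suc k). (if j = Suc (Suc k) then 1 else 0::real)) = 1"
      "x = (\<Sum>j=1..Suc (Suc k). (if j = Suc (Suc k) then 1 else 0::real) *\<^sub>R e)"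
      using True by (simp_all flip: scaleR_sum_left)
    then show ?thesis using e
      by (intro exI[of _ "\<lambda>j. if j = Suc (Suc k) then 1 else 0"] exI[of _ "\<lambda>_. e"]) simp
  next
    case False
    have "x - e \<in> two_sided_directions C x"
      using two_sided_directionsI[of C x \<epsilon> 1 "x - e"] C(1) Suc.prems(1) e \<open>e \<in> C\<close> by simp
    then obtain t where t: "t \<ge> 0" "x + t *\<^sub>R (x - e) \<in> C"
      "\<And>B. finite B \<Longrightarrow> independent B \<Longrightarrow> B \<subseteq> two_sided_directions C (x + t *\<^sub>R (x - e)) \<Longrightarrow> card B \<le> k"
      using last_point_fewer_directions[OF C _ _ Suc.prems(2), of "x - e"] False by auto
    define z where "z = x + t *\<^sub>R (x - e)"
    obtain c u where cu: "\<forall>j\<in>{1..Suc k}. 0 \<le> c j \<and> u j extreme_point_of C"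
        "(\<Sum>j=1..Suc k. c j) = 1" "z = (\<Sum>j=1..Suc k. c j *\<^sub>R u j)"
      using Suc.IH[OF t(2,3)] unfolding z_def by blast
    define a where "a = 1 / (1 + t)"
    have a: "0 \<le> a" "a \<le> 1" "a * (1 + t) = 1" using t by (auto simp: a_def)
    have x: "x = a *\<^sub>R z + (1 - a) *\<^sub>R e"
    proof -
      have "a *\<^sub>R z + (1 - a) *\<^sub>R e = (a * (1 + t)) *\<^sub>R x + (1 - a * (1 + t)) *\<^sub>R e"
        by (simp add: z_def algebra_simps)
      then show ?thesis using a by simp
    qed
    define c' where "c' j = (if j = Suc (Suc k) then 1 - a else a * c j)" for j
    define u' where "u' = u(Suc (Suc k) := e)"
    have "(\<Sum>j=1..Suc k. c' j) = (\<Sum>j=1..Suc k. a * c j)"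
      by (intro sum.cong) (auto simp: c'_def)
    then have "(\<Sum>j=1..Suc k. c' j) = a"
      using cu(2) by (simp only: sum_distrib_left[symmetric] mult_1_right)
    then have s: "(\<Sum>j=1..Suc (Suc k). c' j) = 1"
      by (subst sum.cl_ivl_Suc) (simp add: c'_def)
    have "(\<Sum>j=1..Suc k. c' j *\<^sub>R u' j) = (\<Sum>j=1..Suc k. a *\<^sub>R c j *\<^sub>R u j)"
      by (intro sum.cong) (auto simp: c'_def u'_def)
    then have "(\<Sum>j=1..Suc k. c' j *\<^sub>R u' j) = a *\<^sub>R z"
      using cu(3) by (simp only: scaleR_sum_right[symmetric])
    then have "x = (\<Sum>j=1..Suc (Suc k). c' j *\<^sub>R u' j)"
      by (subst sum.cl_ivl_Suc) (simp add: c'_def u'_def x)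
    moreover have "\<forall>j\<in>{1..Suc (Suc k)}. 0 \<le> c' j \<and> u' j extreme_point_of C"
      using cu(1) a e by (auto simp: c'_def u'_def)
    ultimately show ?thesis using s by blast
  qed
qed

section \<open>Dimension from separating functionals\<close>

text \<open>Each functional cuts the dimension by at most one: a vector \<open>v\<close> on which it does not vanish,
  together with a spanning set of its kernel, spans the whole space.\<close>

lemma spanning_set_of_separating_functionals:
  fixes \<phi> :: "'i \<Rightarrow> 'a::real_vector \<Rightarrow> real"
  assumes "finite I" "\<And>i. i \<in> I \<Longrightarrow> linear (\<phi> i)" "subspace L"
    and "\<And>d. d \<in> L \<Longrightarrow> (\<And>i. i \<in> I \<Longrightarrow> \<phi> i d = 0) \<Longrightarrow> d = 0"
  shows "\<exists>B. finite B \<and> card B \<le> card I \<and> L \<subseteq> span B"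
  using assms
proof (induction I arbitrary: L rule: finite_induct)
  case empty
  then show ?case by (intro exI[of _ "{}"]) auto
next
  case (insert i I)
  have lin: "linear (\<phi> i)" using insert.prems by simp
  define K where "K = L \<inter> {d. \<phi> i d = 0}"
  have "subspace K"
    using insert.prems(2)
    by (simp add: K_def subspace_def linear_0[OF lin] linear_add[OF lin] linear_scale[OF lin])
  then obtain B where B: "finite B" "card B \<le> card I" "K \<subseteq> span B"
    using insert.IH[of K] insert.prems(1,3) unfolding K_def by fastforce
  show ?case
  proof (cases "L \<subseteq> K")
    case True
    then show ?thesis using B insert.hyps by (intro exI[of _ B]) auto
  next
    case False
    then obtain v where v: "v \<in> L" "\<phi> i v \<noteq> 0" by (auto simp: K_def)
    have "L \<subseteq> span (insert v B)"
    proof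
      fix d assume d: "d \<in> L"
      let ?w = "d - (\<phi> i d / \<phi> i v) *\<^sub>R v"
      have "?w \<in> K"
        using d v insert.prems(2)
        by (auto simp: K_def subspace_diff subspace_scale linear_diff[OF lin] linear_scale[OF lin])
      then have "?w \<in> span B" using B by blast
      then show "d \<in> span (insert v B)" by (auto simp: span_insert)
    qed
    then show ?thesis
      using B insert.hyps by (intro exI[of _ "insert v B"]) (auto simp: card_insert_if)
  qed
qed

lemma card_independent_le_separating_functionals:
  fixes \<phi> :: "'i \<Rightarrow> 'a::real_vector \<Rightarrow> real"
  assumes "finite I" "\<And>i. i \<in> I \<Longrightarrow> linear (\<phi> i)" "subspace L"
    and "\<And>d. d \<in> L \<Longrightarrow> (\<And>i. i \<in> I \<Longrightarrow> \<phi> i d = 0) \<Longrightarrow> d = 0"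
    and "independent B" "B \<subseteq> L"
  shows "card B \<le> card I"
proof -
  obtain A where "finite A" "card A \<le> card I" "L \<subseteq> span A"
    using spanning_set_of_separating_functionals[of I \<phi> L] assms by blast
  then show ?thesis
    using independent_span_bound[of A B] assms(5,6) by fastforce
qed

section \<open>The subdifferential of the norm and minimal norm interpolation\<close>

lemma norm_subdifferential_iff:
  fixes J :: "'b::real_normed_vector \<Rightarrow> ('a::real_normed_vector \<Rightarrow>\<^sub>L real)"
  assumes "isometric_dual J"
  shows "f \<in> norm_subdifferential J \<nu> \<longleftrightarrow> norm f \<le> 1 \<and> blinfun_apply (J f) \<nu> = norm \<nu>"
proof
  assume f: "f \<in> norm_subdifferential J \<nu>"
  have sub: "blinfun_apply (J f) (\<mu> - \<nu>) \<le> norm \<mu> - norm \<nu>" for \<mu>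
    using f by (auto simp: norm_subdifferential_def)
  have le: "blinfun_apply (J f) h \<le> norm h" for h
    using sub[of "\<nu> + h"] norm_triangle_ineq[of \<nu> h] by simp
  have "\<bar>blinfun_apply (J f) h\<bar> \<le> norm h" for h
    using le[of h] le[of "- h"] by (simp add: blinfun.minus_right)
  then have "norm (J f) \<le> 1" by (intro norm_blinfun_bound) auto
  then have "norm f \<le> 1" using assms by (simp add: isometric_dual_def)
  moreover have "blinfun_apply (J f) \<nu> = norm \<nu>"
    using sub[of 0] le[of \<nu>] by (simp add: blinfun.minus_right)
  ultimately show "norm f \<le> 1 \<and> blinfun_apply (J f) \<nu> = norm \<nu>" by simp
next
  assume f: "norm f \<le> 1 \<and> blinfun_apply (J f) \<nu> = norm \<nu>"
  have "blinfun_apply (J f) \<mu> \<le> norm \<mu>" for \<mu>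
  proof -
    have "blinfun_apply (J f) \<mu> \<le> norm (J f) * norm \<mu>"
      using norm_blinfun[of "J f" \<mu>] by simp
    also have "\<dots> \<le> norm \<mu>"
      using f assms by (auto simp: isometric_dual_def intro: mult_left_le_one_le)
    finally show ?thesis .
  qed
  then show "f \<in> norm_subdifferential J \<nu>"
    using f by (auto simp: norm_subdifferential_def blinfun.diff_right)
qed

lemma linear_pairing:
  assumes "isometric_dual J"
  shows "linear (\<lambda>f. blinfun_apply (J f) \<nu>)"
proof -
  have "linear J" using assms by (simp add: isometric_dual_def)
  then show ?thesis
    by (intro linearI) (simp_all add: linear_add linear_scale blinfun.add_left blinfun.scaleR_left)
qed

lemma continuous_on_pairing:
  assumes "isometric_dual J"
  shows "continuous_on UNIV (\<lambda>f. blinfun_apply (J f) \<nu>)"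
proof -
  have "bounded_linear J"
    using assms
    by (auto simp: isometric_dual_def linear_conv_bounded_linear bounded_linear_def bounded_linear_axioms_def
        intro!: exI[of _ 1])
  then have "continuous_on UNIV J" by (simp add: linear_continuous_on)
  then show ?thesis by (intro continuous_intros)
qed

lemma norm_subdifferential_convex_closed_bounded:
  fixes J :: "'b::real_normed_vector \<Rightarrow> ('a::real_normed_vector \<Rightarrow>\<^sub>L real)"
  assumes "isometric_dual J"
  shows "convex (norm_subdifferential J \<nu>)" "closed (norm_subdifferential J \<nu>)"
    "bounded (norm_subdifferential J \<nu>)"
proof -
  have eq: "norm_subdifferential J \<nu> = cball 0 1 \<inter> (\<lambda>f. blinfun_apply (J f) \<nu>) -` {norm \<nu>}"
    using norm_subdifferential_iff[OF assms] by auto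
  show "convex (norm_subdifferential J \<nu>)"
    unfolding eq using linear_pairing[OF assms]
    by (intro convex_Int convex_cball convex_linear_vimage) auto
  show "closed (norm_subdifferential J \<nu>)"
    unfolding eq using continuous_on_pairing[OF assms]
    by (intro closed_Int closed_vimage) auto
  show "bounded (norm_subdifferential J \<nu>)"
    unfolding eq by (intro bounded_Int) auto
qed

lemma span_image_sum:
  fixes \<nu> :: "'i \<Rightarrow> 'a::real_vector"
  assumes "finite I" "v \<in> span (\<nu> ` I)"
  obtains c where "v = (\<Sum>i\<in>I. c i *\<^sub>R \<nu> i)"
proof -
  have "\<exists>c. v = (\<Sum>i\<in>I. c i *\<^sub>R \<nu> i)"
    using assms
  proof (induction I arbitrary: v rule: finite_induct)
    case (insert i I)
    then obtain k where "v - k *\<^sub>R \<nu> i \<in> span (\<nu> ` I)" by (auto simp: span_insert)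
    then obtain c where "v - k *\<^sub>R \<nu> i = (\<Sum>i\<in>I. c i *\<^sub>R \<nu> i)" using insert.IH by blast
    moreover have "(\<Sum>j\<in>I. (c(i := k)) j *\<^sub>R \<nu> j) = (\<Sum>j\<in>I. c j *\<^sub>R \<nu> j)"
      using insert.hyps by (intro sum.cong) auto
    ultimately show ?case
      using insert.hyps by (intro exI[of _ "c(i := k)"]) (simp add: algebra_simps)
  qed auto
  then show ?thesis using that by blast
qed

text \<open>All interpolants take the same value \<open>\<parallel>v\<parallel>\<^sup>2\<close> at \<open>v\<close>, which bounds their norms from below
  by \<open>\<parallel>v\<parallel>\<close>; the bound is attained precisely on \<open>\<parallel>v\<parallel>\<close> times the subdifferential at \<open>v\<close>.\<close>

lemma min_norm_interpolant_iff:
  fixes J :: "'b::real_normed_vector \<Rightarrow> ('a::real_normed_vector \<Rightarrow>\<^sub>L real)"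
  assumes J: "isometric_dual J"
    and v: "v \<in> span (\<nu> ` {1..n})" "v \<noteq> 0"
    and g: "g \<in> norm_subdifferential J v" "norm v *\<^sub>R g \<in> interpolants J n \<nu> y"
  shows "f \<in> min_norm_interpolants J n \<nu> y \<longleftrightarrow>
    f \<in> interpolants J n \<nu> y \<and> (1 / norm v) *\<^sub>R f \<in> norm_subdifferential J v"
proof -
  note lin = linear_pairing[OF J]
  obtain c where c: "v = (\<Sum>j=1..n. c j *\<^sub>R \<nu> j)"
    using span_image_sum[OF _ v(1)] by blast
  have at_v: "blinfun_apply (J h) v = (\<Sum>j=1..n. c j * y j)" if "h \<in> interpolants J n \<nu> y" for h
    using that unfolding c
    by (auto simp: interpolants_def blinfun.sum_right blinfun.scaleR_right intro!: sum.cong)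
  have val: "blinfun_apply (J h) v = norm v * norm v" if "h \<in> interpolants J n \<nu> y" for h
    using at_v[OF that] at_v[OF g(2)] g(1) linear_scale[OF lin, of "norm v" g]
    by (simp add: norm_subdifferential_iff[OF J])
  have ge: "norm v \<le> norm h" if "h \<in> interpolants J n \<nu> y" for h
  proof -
    have "norm v * norm v \<le> norm (J h) * norm v"
      using norm_blinfun[of "J h" v] val[OF that] by simp
    then show ?thesis using v J by (simp add: isometric_dual_def)
  qed
  have "norm (norm v *\<^sub>R g) \<le> norm v"
    using g(1) by (auto simp: norm_subdifferential_iff[OF J] intro: mult_left_le)
  then have "norm (norm v *\<^sub>R g) = norm v" using ge[OF g(2)] by simp
  then have "(INF h\<in>interpolants J n \<nu> y. norm h) = norm v"
    using g(2) ge by (intro cInf_eq_minimum) (auto simp: image_iff intro: bexI[of _ "norm v *\<^sub>R g"])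
  moreover have "blinfun_apply (J ((1 / norm v) *\<^sub>R f)) v = blinfun_apply (J f) v / norm v"
    by (simp add: linear_scale[OF lin])
  ultimately show ?thesis
    using val[of f] ge[of f] v
    by (auto simp: min_norm_interpolants_def norm_subdifferential_iff[OF J] field_simps)
qed

section \<open>The representation of extreme minimal norm interpolants\<close>

theorem proposition7:
  fixes J :: "'b::banach \<Rightarrow> ('a::banach \<Rightarrow>\<^sub>L real)"
    and n :: nat and \<nu> :: "nat \<Rightarrow> 'a" and y :: "nat \<Rightarrow> real"
    and \<nu>_hat :: 'a and f_hat :: 'b
  assumes "isometric_dual J"
    and "n \<ge> 1"
    and "inj_on \<nu> {1..n}" and "independent (\<nu> ` {1..n})"
    and "\<exists>j\<in>{1..n}. y j \<noteq> 0"
    and "\<nu>_hat \<in> span (\<nu> ` {1..n})"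
    and "((\<lambda>f. norm \<nu>_hat *\<^sub>R f) ` norm_subdifferential J \<nu>_hat) \<inter> interpolants J n \<nu> y \<noteq> {}"
    and "f_hat extreme_point_of min_norm_interpolants J n \<nu> y"
  shows "\<exists>(\<gamma> :: nat \<Rightarrow> real) (u :: nat \<Rightarrow> 'b).
      (\<Sum>j=1..n. \<gamma> j) = norm \<nu>_hat \<and>
      (\<forall>j\<in>{1..n}. u j extreme_point_of norm_subdifferential J \<nu>_hat) \<and>
      f_hat = (\<Sum>j=1..n. \<gamma> j *\<^sub>R u j)"
proof -
  note J = assms(1)
  note lin = linear_pairing[OF J]
  note C = norm_subdifferential_convex_closed_bounded[OF J, of \<nu>_hat]
  let ?C = "norm_subdifferential J \<nu>_hat"
  let ?S = "min_norm_interpolants J n \<nu> y"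
  obtain g where g: "g \<in> ?C" "norm \<nu>_hat *\<^sub>R g \<in> interpolants J n \<nu> y"
    using assms(7) by auto
  have nz: "\<nu>_hat \<noteq> 0"
    using g(2) assms(5) linear_0[OF lin] by (auto simp: interpolants_def)
  note S = min_norm_interpolant_iff[OF J assms(6) nz g]
  define r where "r = norm \<nu>_hat"
  define x where "x = (1 / r) *\<^sub>R f_hat"
  have r: "r > 0" using nz by (simp add: r_def)
  have fS: "f_hat \<in> ?S" using assms(8) by (simp add: extreme_point_of_def)
  then have x: "x \<in> ?C" and fI: "f_hat \<in> interpolants J n \<nu> y"
    using S[of f_hat] by (auto simp: x_def r_def)
  define L where "L = two_sided_directions ?C x"
  have L_hat: "blinfun_apply (J d) \<nu>_hat = 0" if d: "d \<in> L" for d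
  proof -
    obtain \<epsilon> where \<epsilon>: "\<epsilon> > 0" "x + \<epsilon> *\<^sub>R d \<in> ?C"
      using d by (auto simp: L_def two_sided_directions_def)
    then have "blinfun_apply (J (x + \<epsilon> *\<^sub>R d)) \<nu>_hat = blinfun_apply (J x) \<nu>_hat"
      using x by (simp add: norm_subdifferential_iff[OF J])
    then show ?thesis
      using \<epsilon> by (simp add: linear_add[OF lin] linear_scale[OF lin])
  qed
  have L_all: "d = 0" if d: "d \<in> L" "\<And>j. j \<in> {1..n} \<Longrightarrow> blinfun_apply (J d) (\<nu> j) = 0" for d
  proof -
    obtain \<epsilon> where \<epsilon>: "\<epsilon> > 0" "x + \<epsilon> *\<^sub>R d \<in> ?C" "x - \<epsilon> *\<^sub>R d \<in> ?C"
      using d by (auto simp: L_def two_sided_directions_def)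
    have "f_hat + (r * \<epsilon>) *\<^sub>R d \<in> interpolants J n \<nu> y" "f_hat - (r * \<epsilon>) *\<^sub>R d \<in> interpolants J n \<nu> y"
      using fI d(2)
      by (simp_all add: interpolants_def linear_add[OF lin] linear_diff[OF lin] linear_scale[OF lin])
    moreover have "(1 / r) *\<^sub>R (f_hat + (r * \<epsilon>) *\<^sub>R d) = x + \<epsilon> *\<^sub>R d"
      "(1 / r) *\<^sub>R (f_hat - (r * \<epsilon>) *\<^sub>R d) = x - \<epsilon> *\<^sub>R d"
      using r by (simp_all add: x_def algebra_simps)
    ultimately have in_S: "f_hat + (r * \<epsilon>) *\<^sub>R d \<in> ?S" "f_hat - (r * \<epsilon>) *\<^sub>R d \<in> ?S"
      using \<epsilon> S unfolding r_def by auto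
    have "convex ?S"
    proof -
      have "?S = interpolants J n \<nu> y \<inter> (\<lambda>f. (1 / r) *\<^sub>R f) -` ?C"
        using S by (auto simp: r_def)
      moreover have "convex (interpolants J n \<nu> y)"
        by (auto simp: convex_def interpolants_def linear_add[OF lin] linear_scale[OF lin]
            simp flip: distrib_right)
      moreover have "convex ((\<lambda>f. (1 / r) *\<^sub>R f) -` ?C)"
        using C(1) by (intro convex_linear_vimage) auto
      ultimately show ?thesis by (simp add: convex_Int)
    qed
    then have "two_sided_directions ?S f_hat \<subseteq> {0}"
      using assms(8) extreme_point_of_iff_two_sided_directions by blast
    moreover have "d \<in> two_sided_directions ?S f_hat"
      using in_S r \<epsilon> by (auto simp: two_sided_directions_def intro!: exI[of _ "r * \<epsilon>"])
    ultimately show ?thesis by blast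
  qed
  obtain c where c: "\<nu>_hat = (\<Sum>j=1..n. c j *\<^sub>R \<nu> j)"
    using span_image_sum[OF _ assms(6)] by blast
  obtain i where i: "i \<in> {1..n}" "c i \<noteq> 0"
    using c nz by (metis (no_types, lifting) scaleR_zero_left sum.neutral)
  \<comment> \<open>On \<open>L\<close> the functional \<open>\<nu> i\<close> is a combination of the other ones, since \<open>\<nu>_hat\<close> vanishes there.\<close>
  have L_sep: "d = 0" if d: "d \<in> L" "\<And>j. j \<in> {1..n} - {i} \<Longrightarrow> blinfun_apply (J d) (\<nu> j) = 0" for d
  proof (rule L_all[OF d(1)])
    have "0 = (\<Sum>j=1..n. c j * blinfun_apply (J d) (\<nu> j))"
      using L_hat[OF d(1)] by (simp add: c blinfun.sum_right blinfun.scaleR_right)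
    also have "\<dots> = c i * blinfun_apply (J d) (\<nu> i)"
      using i d(2) by (subst sum.remove[of _ i]) auto
    finally have "blinfun_apply (J d) (\<nu> i) = 0" using i by simp
    then show "blinfun_apply (J d) (\<nu> j) = 0" if "j \<in> {1..n}" for j
      using d(2) that by (cases "j = i") auto
  qed
  have "card B \<le> n - 1" if "finite B" "independent B" "B \<subseteq> two_sided_directions ?C x" for B
    using card_independent_le_separating_functionals[of "{1..n} - {i}"
        "\<lambda>j f. blinfun_apply (J f) (\<nu> j)" L B]
      lin subspace_two_sided_directions[OF C(1) x] L_sep that i
    by (simp add: L_def)
  then obtain w u where wu: "\<forall>j\<in>{1..n}. 0 \<le> w j \<and> u j extreme_point_of ?C"
      "(\<Sum>j=1..n. w j) = 1" "x = (\<Sum>j=1..n. w j *\<^sub>R u j)"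
    using convex_combination_of_extreme_points[OF C x, of "n - 1"] assms(2) by auto
  have "f_hat = r *\<^sub>R x" using r by (simp add: x_def)
  also have "\<dots> = (\<Sum>j=1..n. (r * w j) *\<^sub>R u j)" by (simp add: wu(3) scaleR_sum_right)
  finally have "f_hat = (\<Sum>j=1..n. (r * w j) *\<^sub>R u j)" .
  moreover have "(\<Sum>j=1..n. r * w j) = norm \<nu>_hat"
    using wu(2) by (simp flip: sum_distrib_left add: r_def)
  ultimately show ?thesis using wu(1) by (intro exI[of _ "\<lambda>j. r * w j"] exI[of _ u]) auto
qed

end
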